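(* Let $N\in\mathbb{N}$, let $y_1(0),\dots,y_N(0)\in\mathbb{C}\setminus\{0\}$ be pairwise distinct, let $\zeta_1,\dots,\zeta_N\in\mathbb{R}$, $\xi\in\mathbb{R}\setminus\{0\}$, and $\xi_1=-\frac13\xi$, $\xi_2=\xi_3=\frac23\xi$. Let $T>0$ and let $(z,y):(0,T)\to\mathbb{C}^3\times\mathbb{C}^N$ be a solution of $$\dot{\bar z}_j=\frac1{2\pi i}\sum_{\ell\in\{1,2,3\},\,\ell\neq j}\frac{\xi_\ell}{z_j-z_\ell}+\frac1{2\pi i}\sum_{h=1}^N\frac{\zeta_h}{z_j-y_h},\qquad j=1,2,3,$$ $$\dot{\bar y}_k=\frac1{2\pi i}\sum_{\ell=1}^3\frac{\xi_\ell}{y_k-z_\ell}+\frac1{2\pi i}\sum_{h\in\{1,\dots,N\},\,h\neq k}\frac{\zeta_h}{y_k-y_h},\qquad k=1,\dots,N,$$ with $\lim_{t\to0}z_j(t)=0$ for $j=1,2,3$ and $\lim_{t\to0}y_k(t)=y_k(0)$ for $k=1,\dots,N$, which bursts asymptotically to the self-similar shape $(a_1,a_2,a_3)$ specified in the context, i.e. $z_1(t)\neq0$ for $t\in(0,T)$ and $$\lim_{t\to0}\frac{z_j(t)}{z_1(t)}=\frac{a_j}{a_1},\qquad j=2,3.$$ Let $$\omega_t=\sum_{\ell=1}^3\xi_\ell\delta_{z_\ell(t)}+\sum_{k=1}^N\zeta_k\delta_{y_k(t)}\quad (0<t<T),\qquad \omega_0=\xi\delta_0+\sum_{k=1}^N\zeta_k\delta_{y_k(0)}.$$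 Then $H(\omega_t)$ is constant for $t\in(0,T)$, but $H(\omega_0)>H(\omega_t)$ for every $t\in(0,T)$.
   Context: A bar denotes complex conjugation; $\mathbb{C}=\mathbb{R}^2$. A solution is a $C^1$ curve along which the $N+3$ points are pairwise distinct for every $t\in(0,T)$ and which satisfies the equations. For a finite configuration $\omega=\sum_{j=1}^n\eta_j\delta_{p_j}$ with pairwise distinct points $p_j$ and $\eta_j\in\mathbb{R}$, the (renormalised) energy is $$H(\omega)=-\frac1{2\pi}\sum_{j\ne k}\eta_j\eta_k\log|p_j-p_k|.$$ The parameters are: if $\xi>0$, $a_1=-2+2\sqrt3\,i$, $a_2=-2+\sqrt3\,i$, $a_3=1$; if $\xi<0$, $a_1=2+2\sqrt3\,i$, $a_2=2+\sqrt3\,i$, $a_3=-1$. *)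

theory Defs
  imports "HOL-Analysis.Analysis" "HOL-Library.Poly_Mapping"
begin

text \<open>
  A finite configuration of point vortices, i.e. a finite real combination of Dirac masses in the
  plane, is a finitely supported function \<^typ>\<open>complex \<Rightarrow>\<^sub>0 real\<close>, where
  \<^term>\<open>Poly_Mapping.single p \<eta>\<close> is \<open>\<eta> \<delta>\<^sub>p\<close>.
\<close>

type_synonym configuration = "complex \<Rightarrow>\<^sub>0 real"

definition energy :: "configuration \<Rightarrow> real" where
  "energy \<omega> = - (1 / (2 * pi)) *
     (\<Sum>p \<in> Poly_Mapping.keys \<omega>. \<Sum>q \<in> Poly_Mapping.keys \<omega> - {p}.
        Poly_Mapping.lookup \<omega> p * Poly_Mapping.lookup \<omega> q * ln (cmod (p - q)))"

text \<open>
  The keys are the atoms of nonzero weight; the following lemma recovers the formula for an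
  arbitrary representation by pairwise distinct points, possibly with zero weights.
\<close>

lemma energy_sum_single:
  fixes p :: "'i \<Rightarrow> complex" and \<eta> :: "'i \<Rightarrow> real"
  assumes fin: "finite I" and inj: "inj_on p I"
  shows "energy (\<Sum>j\<in>I. Poly_Mapping.single (p j) (\<eta> j)) =
    - (1 / (2 * pi)) * (\<Sum>j\<in>I. \<Sum>k\<in>I - {j}. \<eta> j * \<eta> k * ln (cmod (p j - p k)))"
proof -
  define \<omega> where "\<omega> = (\<Sum>j\<in>I. Poly_Mapping.single (p j) (\<eta> j))"
  have lk: "Poly_Mapping.lookup \<omega> x = (\<Sum>j\<in>I. \<eta> j when p j = x)" for x
    by (simp add: \<omega>_def Poly_Mapping.lookup_sum Poly_Mapping.lookup_single)
  have lk_p: "Poly_Mapping.lookup \<omega> (p i) = \<eta> i" if "i \<in> I" for i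
  proof -
    have "(\<Sum>j\<in>I. \<eta> j when p j = p i) = (\<Sum>j\<in>I. if j = i then \<eta> j else 0)"
      by (rule sum.cong) (use inj that in \<open>auto simp: when_def inj_on_def\<close>)
    then show ?thesis using fin that by (simp add: lk)
  qed
  have keys: "Poly_Mapping.keys \<omega> \<subseteq> p ` I"
  proof
    fix x assume x: "x \<in> Poly_Mapping.keys \<omega>"
    show "x \<in> p ` I"
    proof (rule ccontr)
      assume "x \<notin> p ` I"
      then have "(\<Sum>j\<in>I. \<eta> j when p j = x) = 0"
        by (intro sum.neutral) (auto simp: when_def)
      with x show False
        by (simp add: in_keys_iff lk)
    qed
  qed
  let ?g = "\<lambda>x y. Poly_Mapping.lookup \<omega> x * Poly_Mapping.lookup \<omega> y * ln (cmod (x - y))"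
  have "(\<Sum>x \<in> Poly_Mapping.keys \<omega>. \<Sum>y \<in> Poly_Mapping.keys \<omega> - {x}. ?g x y)
      = (\<Sum>x \<in> p ` I. \<Sum>y \<in> Poly_Mapping.keys \<omega> - {x}. ?g x y)"
    by (rule sum.mono_neutral_left) (use fin keys in \<open>auto simp: in_keys_iff\<close>)
  also have "\<dots> = (\<Sum>x \<in> p ` I. \<Sum>y \<in> p ` I - {x}. ?g x y)"
    by (intro sum.cong refl sum.mono_neutral_left)
       (use fin keys in \<open>auto simp: in_keys_iff\<close>)
  also have "\<dots> = (\<Sum>j\<in>I. \<Sum>y \<in> p ` I - {p j}. ?g (p j) y)"
    by (simp add: sum.reindex[OF inj])
  also have "\<dots> = (\<Sum>j\<in>I. \<Sum>k\<in>I - {j}. \<eta> j * \<eta> k * ln (cmod (p j - p k)))"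
  proof (rule sum.cong[OF refl])
    fix j assume j: "j \<in> I"
    have "p ` I - {p j} = p ` (I - {j})"
      using inj j by (auto simp: inj_on_def)
    moreover have "inj_on p (I - {j})"
      using inj by (rule inj_on_subset) auto
    ultimately show "(\<Sum>y \<in> p ` I - {p j}. ?g (p j) y)
        = (\<Sum>k\<in>I - {j}. \<eta> j * \<eta> k * ln (cmod (p j - p k)))"
      using j by (simp add: sum.reindex lk_p)
  qed
  finally show ?thesis
    unfolding energy_def \<omega>_def[symmetric] by simp
qed

text \<open>
  Only \<open>z j\<close> with \<open>j \<in> {1,2,3}\<close> and \<open>y k\<close> with \<open>k \<in> {1..N}\<close>, at times in \<open>(0,T)\<close>, matter.
\<close>

definition vortex_solution ::
  "real \<Rightarrow> nat \<Rightarrow> (nat \<Rightarrow> real) \<Rightarrow> (nat \<Rightarrow> real) \<Rightarrow>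
    (nat \<Rightarrow> real \<Rightarrow> complex) \<Rightarrow> (nat \<Rightarrow> real \<Rightarrow> complex) \<Rightarrow> bool" where
  "vortex_solution T N \<xi>s \<zeta> z y \<longleftrightarrow>
     (\<forall>j\<in>{1,2,3}. z j C1_differentiable_on {0<..<T}) \<and>
     (\<forall>k\<in>{1..N}. y k C1_differentiable_on {0<..<T}) \<and>
     (\<forall>t\<in>{0<..<T}.
        inj_on (\<lambda>j. z j t) {1,2,3} \<and>
        inj_on (\<lambda>k. y k t) {1..N} \<and>
        (\<forall>j\<in>{1,2,3}. \<forall>k\<in>{1..N}. z j t \<noteq> y k t) \<and>
        (\<forall>j\<in>{1,2,3}. ((\<lambda>s. cnj (z j s)) has_vector_derivative
            1 / (2 * of_real pi * \<i>) *
              (\<Sum>l\<in>{1,2,3} - {j}. of_real (\<xi>s l) / (z j t - z l t))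
          + 1 / (2 * of_real pi * \<i>) *
              (\<Sum>h\<in>{1..N}. of_real (\<zeta> h) / (z j t - y h t))) (at t)) \<and>
        (\<forall>k\<in>{1..N}. ((\<lambda>s. cnj (y k s)) has_vector_derivative
            1 / (2 * of_real pi * \<i>) *
              (\<Sum>l\<in>{1,2,3}. of_real (\<xi>s l) / (y k t - z l t))
          + 1 / (2 * of_real pi * \<i>) *
              (\<Sum>h\<in>{1..N} - {k}. of_real (\<zeta> h) / (y k t - y h t))) (at t)))"

definition burst_shape :: "real \<Rightarrow> nat \<Rightarrow> complex" where
  "burst_shape \<xi> j =
     (if \<xi> > 0
      then (if j = 1 then Complex (-2) (2 * sqrt 3) else if j = 2 then Complex (-2) (sqrt 3) else 1)
      else (if j = 1 then Complex 2 (2 * sqrt 3) else if j = 2 then Complex 2 (sqrt 3) else -1))"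

definition bursts_asymptotically ::
  "real \<Rightarrow> (nat \<Rightarrow> complex) \<Rightarrow> (nat \<Rightarrow> real \<Rightarrow> complex) \<Rightarrow> bool" where
  "bursts_asymptotically T a z \<longleftrightarrow>
     (\<forall>t\<in>{0<..<T}. z 1 t \<noteq> 0) \<and>
     (\<forall>j\<in>{2,3}. ((\<lambda>t. z j t / z 1 t) \<longlongrightarrow> a j / a 1) (at_right 0))"

end

theory Submission imports Defs begin

text \<open>
  The energy is conserved because \<open>\<Sum>\<^sub>k \<eta>\<^sub>k / (p\<^sub>j - p\<^sub>k)\<close> is \<open>2 \<pi> \<i>\<close> times the conjugate of the velocity
  of \<open>p\<^sub>j\<close>, so that the derivative of \<open>H\<close> is a sum of real parts of imaginary numbers. Its value is
  therefore its limit at \<open>t = 0\<close>. The interaction of the burst with the other vortices and of these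
  among themselves tends to \<open>H(\<omega>\<^sub>0)\<close>. The self-interaction of the three burst vortices is
  invariant under scaling, since \<open>\<xi>\<^sub>1 \<xi>\<^sub>2 + \<xi>\<^sub>1 \<xi>\<^sub>3 + \<xi>\<^sub>2 \<xi>\<^sub>3 = 0\<close>, so it tends to its value at the
  shape \<open>(a\<^sub>1, a\<^sub>2, a\<^sub>3)\<close>, which is \<open>- (2 \<xi>\<^sup>2 / (9 \<pi>)) ln (12 / \<surd>63) < 0\<close>.
\<close>

section \<open>Derivative of the pair interactions along the flow\<close>

text \<open>The logarithm of the modulus is the real part of a complex logarithm, so its derivative
  is the real part of the logarithmic derivative. Differentiating the norm directly avoids choosing
  a branch.\<close>

lemma has_real_derivative_ln_cmod:
  fixes f :: "real \<Rightarrow> complex"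
  assumes "(f has_vector_derivative f') (at t)" and "f t \<noteq> 0"
  shows "((\<lambda>s. ln (cmod (f s))) has_real_derivative Re (f' / f t)) (at t)"
proof -
  have "(f has_derivative (\<lambda>h. h *\<^sub>R f')) (at t)"
    using assms(1) by (simp add: has_vector_derivative_def)
  then have "((\<lambda>s. ln (cmod (f s))) has_derivative
      (\<lambda>h. inverse (cmod (f t)) * (inner (sgn (f t)) (h *\<^sub>R f')))) (at t)"
    using assms(2)
    by (auto intro!: derivative_eq_intros has_derivative_compose[OF _ has_derivative_norm] simp: field_simps inner_commute)
  \<comment> \<open>The real inner product of \<open>f t\<close> and \<open>f'\<close> is the real
    part of \<open>f' * cnj (f t)\<close>.\<close>
  moreover have "Re (f' / f t) = inner (f t) f' / (cmod (f t))\<^sup>2"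
    unfolding complex_div_cnj[of f'] by (simp add: inner_complex_def algebra_simps del: of_real_power flip: of_real_power)
  then have "inverse (cmod (f t)) * (inner (sgn (f t)) (h *\<^sub>R f')) = Re (f' / f t) * h" for h
    by (simp add: sgn_div_norm power2_eq_square divide_inverse mult_ac)
  ultimately show ?thesis
    unfolding has_field_derivative_def by (rule has_derivative_eq_rhs[OF _ ext])
qed

text \<open>Symmetrising over ordered pairs turns the derivative into twice the sum of
  \<open>\<eta> j * Re (v j * S j)\<close>, where \<open>v j\<close> is the velocity and
  \<open>S j\<close> the sum in its equation. Since \<open>v j\<close> is an imaginary multiple of
  \<open>cnj (S j)\<close>, every term vanishes. One index set carries all vortices, bursting or
  not.\<close>

lemma vortex_energy_derivative_zero:
  fixes p :: "'i \<Rightarrow> real \<Rightarrow> complex" and \<eta> :: "'i \<Rightarrow> real"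
  assumes fin: "finite I" and inj: "inj_on (\<lambda>j. p j t) I"
    and ode: "\<And>j. j \<in> I \<Longrightarrow> ((\<lambda>s. cnj (p j s)) has_vector_derivative
        1 / (2 * of_real pi * \<i>) * (\<Sum>k\<in>I - {j}. of_real (\<eta> k) / (p j t - p k t))) (at t)"
  shows "((\<lambda>s. \<Sum>j\<in>I. \<Sum>k\<in>I - {j}. \<eta> j * \<eta> k * ln (cmod (p j s - p k s)))
           has_real_derivative 0) (at t)"
proof -
  define S where "S j = (\<Sum>k\<in>I - {j}. of_real (\<eta> k) / (p j t - p k t))" for j
  define v where "v j = cnj (1 / (2 * of_real pi * \<i>) * S j)" for j
  have v: "(p j has_vector_derivative v j) (at t)" if "j \<in> I" for j
    using has_vector_derivative_cnj[OF ode[OF that]] by (simp add: v_def S_def)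
  have deriv: "((\<lambda>s. \<Sum>j\<in>I. \<Sum>k\<in>I - {j}. \<eta> j * \<eta> k * ln (cmod (p j s - p k s)))
      has_real_derivative
      (\<Sum>j\<in>I. \<Sum>k\<in>I - {j}. \<eta> j * \<eta> k * Re ((v j - v k) / (p j t - p k t)))) (at t)"
  proof (intro DERIV_sum DERIV_cmult has_real_derivative_ln_cmod has_vector_derivative_diff v)
    fix j k assume "j \<in> I" "k \<in> I - {j}"
    then show "p j t - p k t \<noteq> 0" using inj by (auto simp: inj_on_def)
  qed auto
  define X where "X j k = \<eta> j * \<eta> k * Re (v j / (p j t - p k t))" for j k
  \<comment> \<open>The contributions of the velocities of \<open>j\<close> and \<open>k\<close>
    differ only by exchanging the indices, because both the velocity difference and the denominator
    change sign.\<close>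
  have split: "\<eta> j * \<eta> k * Re ((v j - v k) / (p j t - p k t)) = X j k + X k j" for j k
  proof -
    have "(v j - v k) / (p j t - p k t) = v j / (p j t - p k t) + v k / (p k t - p j t)"
      by (metis diff_divide_distrib minus_diff_eq minus_divide_right uminus_add_conv_diff add.commute)
    then show ?thesis by (simp add: X_def algebra_simps)
  qed
  have swap: "(\<Sum>j\<in>I. \<Sum>k\<in>I - {j}. X k j) = (\<Sum>j\<in>I. \<Sum>k\<in>I - {j}. X j k)"
  proof -
    have "(\<Sum>j\<in>I. \<Sum>k\<in>{k\<in>I. k \<noteq> j}. X k j) = (\<Sum>k\<in>I. \<Sum>j\<in>{j\<in>I. k \<noteq> j}. X k j)"
      using fin fin by (rule sum.swap_restrict)
    moreover have "{k\<in>I. k \<noteq> j} = I - {j}" "{k\<in>I. j \<noteq> k} = I - {j}" for j by auto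
    ultimately show ?thesis by simp
  qed
  have "(\<Sum>k\<in>I - {j}. X j k) = \<eta> j * Re (v j * S j)" for j
  proof -
    have "X j k = \<eta> j * Re (v j * (of_real (\<eta> k) / (p j t - p k t)))" for k
    proof -
      have "v j * (of_real (\<eta> k) / (p j t - p k t)) = of_real (\<eta> k) * (v j / (p j t - p k t))"
        by simp
      then show ?thesis by (simp add: X_def del: times_divide_eq_right)
    qed
    then show ?thesis by (simp add: S_def sum_distrib_left)
  qed
  \<comment> \<open>The conjugate of 1/(2 pi i) is i/(2 pi), so the product is i/(2 pi) times the
    squared modulus of \<open>S j\<close>.\<close>
  moreover have "Re (v j * S j) = 0" for j
    by (simp add: v_def complex_eq_iff Re_divide Im_divide power2_eq_square)
  ultimately have "(\<Sum>j\<in>I. \<Sum>k\<in>I - {j}. X j k) = 0" by simp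
  then have "(\<Sum>j\<in>I. \<Sum>k\<in>I - {j}. \<eta> j * \<eta> k * Re ((v j - v k) / (p j t - p k t))) = 0"
    by (simp only: split sum.distrib swap)
  with deriv show ?thesis by simp
qed

section \<open>Energy of two disjoint families of vortices\<close>

lemma Plus_diff_Inl: "(A <+> B) - {Inl a} = (A - {a}) <+> B"
  and Plus_diff_Inr: "(A <+> B) - {Inr b} = A <+> (B - {b})"
  by auto

lemma inj_on_case_sum_Plus:
  assumes "inj_on p A" "inj_on q B" and "\<And>i k. i \<in> A \<Longrightarrow> k \<in> B \<Longrightarrow> p i \<noteq> q k"
  shows "inj_on (case_sum p q) (A <+> B)"
proof (rule inj_onI)
  fix x y assume "x \<in> A <+> B" "y \<in> A <+> B" "case_sum p q x = case_sum p q y"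
  then show "x = y"
    by (elim PlusE) (use assms(3) in \<open>force dest: inj_onD[OF assms(1)] inj_onD[OF assms(2)]\<close>)+
qed

text \<open>Indexing by the disjoint sum merges both families into a single injective family, to
  which the general energy formula applies.\<close>

lemma energy_sum_single_Plus:
  fixes p :: "'i \<Rightarrow> complex" and q :: "'j \<Rightarrow> complex" and \<eta> :: "'i \<Rightarrow> real" and \<theta> :: "'j \<Rightarrow> real"
  assumes fin: "finite A" "finite B" and inj: "inj_on p A" "inj_on q B"
    and disj: "\<And>i k. i \<in> A \<Longrightarrow> k \<in> B \<Longrightarrow> p i \<noteq> q k"
  defines "P \<equiv> case_sum p q" and "W \<equiv> case_sum \<eta> \<theta>"
  shows "energy ((\<Sum>i\<in>A. Poly_Mapping.single (p i) (\<eta> i)) + (\<Sum>k\<in>B. Poly_Mapping.single (q k) (\<theta> k))) =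
    - (1 / (2 * pi)) * (\<Sum>i\<in>A <+> B. \<Sum>k\<in>(A <+> B) - {i}. W i * W k * ln (cmod (P i - P k)))"
proof -
  have "inj_on P (A <+> B)"
    unfolding P_def using inj disj by (rule inj_on_case_sum_Plus)
  moreover have "finite (A <+> B)" using fin by simp
  ultimately have "energy (\<Sum>i\<in>A <+> B. Poly_Mapping.single (P i) (W i)) =
      - (1 / (2 * pi)) * (\<Sum>i\<in>A <+> B. \<Sum>k\<in>(A <+> B) - {i}. W i * W k * ln (cmod (P i - P k)))"
    by (intro energy_sum_single)
  then show ?thesis
    using fin by (simp add: sum.Plus P_def W_def o_def)
qed

text \<open>The double sum splits into four blocks. The two mixed blocks agree by symmetry of the
  distance, whence the factor 2.\<close>

lemma energy_sum_single_add:
  fixes p :: "'i \<Rightarrow> complex" and q :: "'j \<Rightarrow> complex" and \<eta> :: "'i \<Rightarrow> real" and \<theta> :: "'j \<Rightarrow> real"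
  assumes fin: "finite A" "finite B" and inj: "inj_on p A" "inj_on q B"
    and disj: "\<And>i k. i \<in> A \<Longrightarrow> k \<in> B \<Longrightarrow> p i \<noteq> q k"
  shows "energy ((\<Sum>i\<in>A. Poly_Mapping.single (p i) (\<eta> i)) + (\<Sum>k\<in>B. Poly_Mapping.single (q k) (\<theta> k))) =
    - (1 / (2 * pi)) *
      ((\<Sum>i\<in>A. \<Sum>j\<in>A - {i}. \<eta> i * \<eta> j * ln (cmod (p i - p j)))
       + 2 * (\<Sum>i\<in>A. \<Sum>k\<in>B. \<eta> i * \<theta> k * ln (cmod (p i - q k)))
       + (\<Sum>k\<in>B. \<Sum>h\<in>B - {k}. \<theta> k * \<theta> h * ln (cmod (q k - q h))))"
proof -
  have "(\<Sum>k\<in>B. \<Sum>i\<in>A. \<theta> k * \<eta> i * ln (cmod (q k - p i)))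
      = (\<Sum>i\<in>A. \<Sum>k\<in>B. \<eta> i * \<theta> k * ln (cmod (p i - q k)))"
    by (subst sum.swap) (simp add: norm_minus_commute mult.commute)
  then show ?thesis
    using fin by (subst energy_sum_single_Plus[OF assms])
      (simp_all add: sum.Plus Plus_diff_Inl Plus_diff_Inr o_def sum.distrib)
qed

text \<open>Over the disjoint sum of the index sets, the two sums in each equation of motion become
  one sum over all other vortices. The energy then has derivative zero on an interval.\<close>

lemma vortex_solution_energy_constant:
  assumes sol: "vortex_solution T N \<xi>s \<zeta> z y"
    and \<omega>: "\<And>t. t \<in> {0<..<T} \<Longrightarrow> \<omega> t =
           (\<Sum>l\<in>{1,2,3}. Poly_Mapping.single (z l t) (\<xi>s l))
         + (\<Sum>k\<in>{1..N}. Poly_Mapping.single (y k t) (\<zeta> k))"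
  shows "(\<lambda>t. energy (\<omega> t)) constant_on {0<..<T}"
proof -
  define A :: "nat set" where "A = {1,2,3}"
  define P where "P i t = case_sum (\<lambda>l. z l t) (\<lambda>k. y k t) i" for i t
  define W where "W = case_sum \<xi>s \<zeta>"
  define I where "I = A <+> {1..N}"
  define E where "E t = (\<Sum>i\<in>I. \<Sum>k\<in>I - {i}. W i * W k * ln (cmod (P i t - P k t)))" for t
  have finA: "finite A" by (simp add: A_def)
  have E: "energy (\<omega> t) = - (1 / (2 * pi)) * E t" if t: "t \<in> {0<..<T}" for t
    unfolding \<omega>[OF t] E_def I_def P_def W_def A_def
    by (rule energy_sum_single_Plus) (use sol t in \<open>auto simp: vortex_solution_def\<close>)
  have "(E has_real_derivative 0) (at t)" if t: "t \<in> {0<..<T}" for t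
    unfolding E_def
  proof (rule vortex_energy_derivative_zero)
    show "finite I" by (simp add: I_def finA)
    have "inj_on (\<lambda>j. z j t) A" "inj_on (\<lambda>k. y k t) {1..N}"
      "\<And>j k. j \<in> A \<Longrightarrow> k \<in> {1..N} \<Longrightarrow> z j t \<noteq> y k t"
      using sol t unfolding vortex_solution_def A_def by blast+
    then show "inj_on (\<lambda>j. P j t) I"
      unfolding P_def I_def by (rule inj_on_case_sum_Plus)
    fix j assume j: "j \<in> I"
    show "((\<lambda>s. cnj (P j s)) has_vector_derivative
        1 / (2 * of_real pi * \<i>) * (\<Sum>k\<in>I - {j}. of_real (W k) / (P j t - P k t))) (at t)"
    proof (cases j)
      case (Inl l)
      with j have "l \<in> A" by (auto simp: I_def)
      then have "((\<lambda>s. cnj (z l s)) has_vector_derivative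
            1 / (2 * of_real pi * \<i>) * (\<Sum>i\<in>A - {l}. of_real (\<xi>s i) / (z l t - z i t))
          + 1 / (2 * of_real pi * \<i>) * (\<Sum>h\<in>{1..N}. of_real (\<zeta> h) / (z l t - y h t))) (at t)"
        using sol t unfolding vortex_solution_def A_def by blast
      then show ?thesis
        by (simp add: Inl I_def P_def W_def Plus_diff_Inl sum.Plus finA o_def distrib_left add_divide_distrib)
    next
      case (Inr k)
      with j have "k \<in> {1..N}" by (auto simp: I_def)
      then have "((\<lambda>s. cnj (y k s)) has_vector_derivative
            1 / (2 * of_real pi * \<i>) * (\<Sum>l\<in>A. of_real (\<xi>s l) / (y k t - z l t))
          + 1 / (2 * of_real pi * \<i>) * (\<Sum>h\<in>{1..N} - {k}. of_real (\<zeta> h) / (y k t - y h t))) (at t)"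
        using sol t unfolding vortex_solution_def A_def by blast
      then show ?thesis
        by (simp add: Inr I_def P_def W_def Plus_diff_Inr sum.Plus finA o_def distrib_left add_divide_distrib)
    qed
  qed
  then have "\<exists>c. \<forall>t\<in>{0<..<T}. E t = c"
    by (intro has_field_derivative_zero_constant) (auto intro: has_field_derivative_at_within)
  then show ?thesis
    unfolding constant_on_def using E by metis
qed

section \<open>Scale invariance and the shape of the burst\<close>

text \<open>Dividing all points by \<open>c\<close> subtracts \<open>ln (cmod c)\<close> times the
  sum of the weight products, which is zero. This lets the collapsing points be replaced by their
  ratios, which have a limit.\<close>

lemma self_interaction_scale:
  fixes \<eta> :: "'i \<Rightarrow> real" and p :: "'i \<Rightarrow> complex"
  assumes "inj_on p A" and "c \<noteq> 0"
    and "(\<Sum>i\<in>A. \<Sum>j\<in>A - {i}. \<eta> i * \<eta> j) = 0"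
  shows "(\<Sum>i\<in>A. \<Sum>j\<in>A - {i}. \<eta> i * \<eta> j * ln (cmod (p i / c - p j / c)))
       = (\<Sum>i\<in>A. \<Sum>j\<in>A - {i}. \<eta> i * \<eta> j * ln (cmod (p i - p j)))"
proof -
  have "\<eta> i * \<eta> j * ln (cmod (p i / c - p j / c))
      = \<eta> i * \<eta> j * ln (cmod (p i - p j)) - \<eta> i * \<eta> j * ln (cmod c)"
    if "i \<in> A" "j \<in> A - {i}" for i j
  proof -
    have "p i \<noteq> p j" using assms(1) that by (auto simp: inj_on_def)
    then have "ln (cmod (p i / c - p j / c)) = ln (cmod (p i - p j)) - ln (cmod c)"
      using assms(2) by (simp add: diff_divide_distrib[symmetric] norm_divide ln_div)
    then show ?thesis by (simp add: right_diff_distrib)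
  qed
  then have "(\<Sum>i\<in>A. \<Sum>j\<in>A - {i}. \<eta> i * \<eta> j * ln (cmod (p i / c - p j / c)))
      = (\<Sum>i\<in>A. \<Sum>j\<in>A - {i}. \<eta> i * \<eta> j * ln (cmod (p i - p j)) - \<eta> i * \<eta> j * ln (cmod c))"
    by (intro sum.cong refl) auto
  also have "\<dots> = (\<Sum>i\<in>A. \<Sum>j\<in>A - {i}. \<eta> i * \<eta> j * ln (cmod (p i - p j)))
      - (\<Sum>i\<in>A. \<Sum>j\<in>A - {i}. \<eta> i * \<eta> j) * ln (cmod c)"
    by (simp add: sum_subtractf sum_distrib_right)
  finally show ?thesis using assms(3) by simp
qed

text \<open>The shapes for the two signs of \<open>\<xi>\<close> are mirror images in the imaginary
  axis, so the distances are the same.\<close>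

lemma cmod_burst_shape_diffs:
  "cmod (burst_shape \<xi> 1 - burst_shape \<xi> 2) = sqrt 3"
  "cmod (burst_shape \<xi> 1 - burst_shape \<xi> 3) = sqrt 21"
  "cmod (burst_shape \<xi> 2 - burst_shape \<xi> 3) = sqrt 12"
  by (auto simp: burst_shape_def cmod_def power_mult_distrib)

lemma inj_on_burst_shape: "inj_on (burst_shape \<xi>) {1,2,3}"
  using cmod_burst_shape_diffs[of \<xi>] by (auto simp: inj_on_def)

lemma burst_shape_1_nonzero: "burst_shape \<xi> 1 \<noteq> 0"
  by (auto simp: burst_shape_def complex_eq_iff)

text \<open>The weight products are -2/9, -2/9 and 4/9 times the square of \<open>\<xi>\<close>, for
  the distances sqrt 3, sqrt 21 and sqrt 12. The sign is therefore decided by 12 * 12 > 3 *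
  21.\<close>

lemma burst_shape_self_interaction_pos:
  assumes "\<xi> \<noteq> 0" and "\<xi>s 1 = - (1 / 3) * \<xi>" and "\<xi>s 2 = 2 / 3 * \<xi>" and "\<xi>s 3 = 2 / 3 * \<xi>"
  shows "(\<Sum>i\<in>{1,2,3}. \<Sum>j\<in>{1,2,3} - {i}. \<xi>s i * \<xi>s j
            * ln (cmod (burst_shape \<xi> i - burst_shape \<xi> j))) > 0"
proof -
  have "({1,2,3} - {1::nat}) = {2,3}" "({1,2,3} - {2::nat}) = {1,3}" "({1,2,3} - {3::nat}) = {1,2}"
    by auto
  moreover have "cmod (burst_shape \<xi> 2 - burst_shape \<xi> 1) = sqrt 3"
    "cmod (burst_shape \<xi> 3 - burst_shape \<xi> 1) = sqrt 21"
    "cmod (burst_shape \<xi> 3 - burst_shape \<xi> 2) = sqrt 12"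
    using cmod_burst_shape_diffs[of \<xi>] by (simp_all add: norm_minus_commute)
  ultimately have "(\<Sum>i\<in>{1,2,3}. \<Sum>j\<in>{1,2,3} - {i}. \<xi>s i * \<xi>s j
            * ln (cmod (burst_shape \<xi> i - burst_shape \<xi> j)))
      = 2 * (\<xi>s 1 * \<xi>s 2 * ln (sqrt 3) + \<xi>s 1 * \<xi>s 3 * ln (sqrt 21) + \<xi>s 2 * \<xi>s 3 * ln (sqrt 12))"
    by (simp add: cmod_burst_shape_diffs cmod_burst_shape_diffs[unfolded One_nat_def] algebra_simps)
  also have "\<dots> = 2 / 9 * \<xi>\<^sup>2 * (2 * ln 12 - (ln 3 + ln 21))"
    by (simp add: assms(2-4) assms(2)[unfolded One_nat_def] ln_sqrt power2_eq_square algebra_simps)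
  also have "2 * ln 12 - (ln 3 + ln 21) = ln (144::real) - ln 63"
    using ln_mult[of "12::real" 12] ln_mult[of "3::real" 21] by simp
  also have "2 / 9 * \<xi>\<^sup>2 * (ln 144 - ln 63) > 0"
    using assms(1) by simp
  finally show ?thesis .
qed

section \<open>Passage to the limit at the burst time\<close>

theorem proposition4p7:
  fixes N :: nat and \<xi> T :: real
    and y0 :: "nat \<Rightarrow> complex" and \<zeta> \<xi>s :: "nat \<Rightarrow> real"
    and z y :: "nat \<Rightarrow> real \<Rightarrow> complex"
    and \<omega> :: "real \<Rightarrow> configuration"
  assumes "\<And>k. k \<in> {1..N} \<Longrightarrow> y0 k \<noteq> 0"
    and "inj_on y0 {1..N}"
    and "\<xi> \<noteq> 0"
    and "\<xi>s 1 = - (1 / 3) * \<xi>" and "\<xi>s 2 = 2 / 3 * \<xi>" and "\<xi>s 3 = 2 / 3 * \<xi>"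
    and "T > 0"
    and "vortex_solution T N \<xi>s \<zeta> z y"
    and "\<And>j. j \<in> {1,2,3} \<Longrightarrow> (z j \<longlongrightarrow> 0) (at_right 0)"
    and "\<And>k. k \<in> {1..N} \<Longrightarrow> (y k \<longlongrightarrow> y0 k) (at_right 0)"
    and "bursts_asymptotically T (burst_shape \<xi>) z"
    and "\<And>t. t \<in> {0<..<T} \<Longrightarrow> \<omega> t =
           (\<Sum>l\<in>{1,2,3}. Poly_Mapping.single (z l t) (\<xi>s l))
         + (\<Sum>k\<in>{1..N}. Poly_Mapping.single (y k t) (\<zeta> k))"
    and "\<omega> 0 = Poly_Mapping.single 0 \<xi> + (\<Sum>k\<in>{1..N}. Poly_Mapping.single (y0 k) (\<zeta> k))"
  shows "(\<lambda>t. energy (\<omega> t)) constant_on {0<..<T} \<and>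
         (\<forall>t\<in>{0<..<T}. energy (\<omega> 0) > energy (\<omega> t))"
proof
  show const: "(\<lambda>t. energy (\<omega> t)) constant_on {0<..<T}"
    using vortex_solution_energy_constant[OF assms(8) assms(12)] .
  define A :: "nat set" where "A = {1,2,3}"
  define a where "a = burst_shape \<xi>"
  \<comment> \<open>The individual logarithms in \<open>self\<close> blow up as the three points
    merge, whereas \<open>rest\<close> stays continuous up to time 0.\<close>
  define self where "self p = (\<Sum>i\<in>A. \<Sum>j\<in>A - {i}. \<xi>s i * \<xi>s j * ln (cmod (p i - p j)))"
    for p :: "nat \<Rightarrow> complex"
  define rest where "rest p q = 2 * (\<Sum>i\<in>A. \<Sum>k\<in>{1..N}. \<xi>s i * \<zeta> k * ln (cmod (p i - q k)))
       + (\<Sum>k\<in>{1..N}. \<Sum>h\<in>{1..N} - {k}. \<zeta> k * \<zeta> h * ln (cmod (q k - q h)))"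
    for p q :: "nat \<Rightarrow> complex"
  have a1: "a 1 \<noteq> 0" by (simp only: a_def burst_shape_1_nonzero not_False_eq_True)
  have injz: "inj_on (\<lambda>j. z j t) A" and injy: "inj_on (\<lambda>k. y k t) {1..N}"
    and zy: "\<And>j k. j \<in> A \<Longrightarrow> k \<in> {1..N} \<Longrightarrow> z j t \<noteq> y k t"
    and z1: "z 1 t \<noteq> 0" if "t \<in> {0<..<T}" for t
    using assms(8,11) that unfolding vortex_solution_def bursts_asymptotically_def A_def by blast+
  have weights: "(\<Sum>i\<in>A. \<Sum>j\<in>A - {i}. \<xi>s i * \<xi>s j) = 0"
  proof -
    have "({1,2,3} - {1::nat}) = {2,3}" "({1,2,3} - {2::nat}) = {1,3}" "({1,2,3} - {3::nat}) = {1,2}"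
      by auto
    then show ?thesis
      by (simp add: A_def assms(4-6) assms(4)[unfolded One_nat_def])
  qed
  have energy_t: "energy (\<omega> t) =
      - (1 / (2 * pi)) * (self (\<lambda>j. z j t / z 1 t) + rest (\<lambda>j. z j t) (\<lambda>k. y k t))"
    if t: "t \<in> {0<..<T}" for t
  proof -
    have "energy (\<omega> t) = - (1 / (2 * pi)) * (self (\<lambda>j. z j t) + rest (\<lambda>j. z j t) (\<lambda>k. y k t))"
      unfolding assms(12)[OF t] self_def rest_def A_def
      by (subst energy_sum_single_add)
         (use injz[OF t] injy[OF t] zy[OF t] in \<open>simp_all add: A_def add.assoc\<close>)
    also have "self (\<lambda>j. z j t) = self (\<lambda>j. z j t / z 1 t)"
      unfolding self_def by (rule self_interaction_scale[symmetric, OF injz[OF t] z1[OF t] weights])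
    finally show ?thesis .
  qed
  \<comment> \<open>At time 0 the burst is a single vortex at the origin, treated as a one-element
    family without self-interaction. Its mixed terms match those of \<open>rest\<close>, because the
    three weights add up to \<open>\<xi>\<close>.\<close>
  have energy_0: "energy (\<omega> 0) = - (1 / (2 * pi)) * rest (\<lambda>_. 0) y0"
  proof -
    have "energy ((\<Sum>i\<in>{0::nat}. Poly_Mapping.single 0 \<xi>) + (\<Sum>k\<in>{1..N}. Poly_Mapping.single (y0 k) (\<zeta> k)))
        = - (1 / (2 * pi)) * (2 * (\<Sum>k\<in>{1..N}. \<xi> * \<zeta> k * ln (cmod (y0 k)))
          + (\<Sum>k\<in>{1..N}. \<Sum>h\<in>{1..N} - {k}. \<zeta> k * \<zeta> h * ln (cmod (y0 k - y0 h))))"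
      by (subst energy_sum_single_add) (use assms(1,2) in \<open>fastforce+\<close>)
    moreover have "(\<Sum>i\<in>A. \<Sum>k\<in>{1..N}. \<xi>s i * \<zeta> k * ln (cmod (y0 k)))
        = (\<Sum>k\<in>{1..N}. \<xi> * \<zeta> k * ln (cmod (y0 k)))"
    proof -
      have "(\<Sum>i\<in>A. \<xi>s i * s) = \<xi> * s" for s
        by (simp add: A_def assms(4-6) assms(4)[unfolded One_nat_def])
      then show ?thesis
        by (simp only: mult.assoc sum_distrib_left[symmetric])
    qed
    ultimately show ?thesis
      unfolding assms(13) rest_def by simp
  qed
  have inja: "inj_on (\<lambda>j. a j / a 1) A"
    using inj_on_burst_shape[of \<xi>] a1 by (auto simp: a_def A_def inj_on_def)
  have near0: "eventually (\<lambda>t. t \<in> {0<..<T}) (at_right (0::real))"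
    using \<open>T > 0\<close> by (rule eventually_at_right_real)
  have lim_shape: "((\<lambda>t. z j t / z 1 t) \<longlongrightarrow> a j / a 1) (at_right 0)" if "j \<in> A" for j
  \<comment> \<open>The bursting condition speaks of the indices 2 and 3; for index 1 the ratio is
    identically 1.\<close>
  proof (cases "j = 1")
    case True
    have "eventually (\<lambda>t. z j t / z 1 t = a j / a 1) (at_right 0)"
      using near0 by (rule eventually_mono) (use True a1 z1 in auto)
    then show ?thesis by (rule tendsto_eventually)
  next
    case False
    then show ?thesis
      using assms(11) that unfolding bursts_asymptotically_def a_def A_def by auto
  qed
  \<comment> \<open>The limiting ratios are pairwise distinct, so each logarithm is continuous
    there.\<close>
  have "((\<lambda>t. self (\<lambda>j. z j t / z 1 t)) \<longlongrightarrow> self (\<lambda>j. a j / a 1)) (at_right 0)"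
    unfolding self_def
    by (intro tendsto_intros lim_shape) (use inja in \<open>auto simp: inj_on_def\<close>)
  moreover have "((\<lambda>t. rest (\<lambda>j. z j t) (\<lambda>k. y k t)) \<longlongrightarrow> rest (\<lambda>_. 0) y0) (at_right 0)"
    unfolding rest_def
  proof (intro tendsto_add tendsto_mult tendsto_sum tendsto_const tendsto_ln tendsto_norm tendsto_diff)
    fix i k assume "i \<in> A" "k \<in> {1..N}"
    then show "((\<lambda>t. z i t) \<longlongrightarrow> 0) (at_right 0)" "((\<lambda>t. y k t) \<longlongrightarrow> y0 k) (at_right 0)"
      "cmod (0 - y0 k) \<noteq> 0"
      using assms(1,9,10) by (simp_all add: A_def)
  next
    fix k h assume "k \<in> {1..N}" "h \<in> {1..N} - {k}"
    then show "((\<lambda>t. y k t) \<longlongrightarrow> y0 k) (at_right 0)" "((\<lambda>t. y h t) \<longlongrightarrow> y0 h) (at_right 0)"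
      "cmod (y0 k - y0 h) \<noteq> 0"
      using assms(10) inj_onD[OF assms(2), of k h] by auto
  qed
  ultimately have "((\<lambda>t. - (1 / (2 * pi)) * (self (\<lambda>j. z j t / z 1 t) + rest (\<lambda>j. z j t) (\<lambda>k. y k t)))
      \<longlongrightarrow> - (1 / (2 * pi)) * (self (\<lambda>j. a j / a 1) + rest (\<lambda>_. 0) y0)) (at_right 0)"
    by (intro tendsto_intros)
  then have lim: "((\<lambda>t. energy (\<omega> t))
      \<longlongrightarrow> - (1 / (2 * pi)) * (self (\<lambda>j. a j / a 1) + rest (\<lambda>_. 0) y0)) (at_right 0)"
    by (rule Lim_transform_eventually)
       (rule eventually_mono[OF near0], simp add: energy_t)
  \<comment> \<open>Scale invariance again, now to remove the normalisation by \<open>a 1\<close>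
    and reach the explicit distances.\<close>
  have "self (\<lambda>j. a j / a 1) = self a"
    unfolding self_def
    by (rule self_interaction_scale[OF _ a1 weights])
       (use inj_on_burst_shape[of \<xi>] in \<open>simp add: a_def A_def\<close>)
  also have "\<dots> > 0"
    unfolding self_def a_def A_def by (rule burst_shape_self_interaction_pos[OF assms(3-6)])
  finally have pos: "self (\<lambda>j. a j / a 1) > 0" .
  obtain c where c: "\<And>t. t \<in> {0<..<T} \<Longrightarrow> energy (\<omega> t) = c"
    using const unfolding constant_on_def by blast
  have "((\<lambda>t. energy (\<omega> t)) \<longlongrightarrow> c) (at_right 0)"
    by (rule tendsto_eventually) (rule eventually_mono[OF near0 c])
  \<comment> \<open>The conserved value is its own limit at time 0. It differs from
    \<open>energy (\<omega> 0)\<close> exactly by the self-interaction of the limiting shape, which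
    enters with a negative factor.\<close>
  then have "c = - (1 / (2 * pi)) * (self (\<lambda>j. a j / a 1) + rest (\<lambda>_. 0) y0)"
    using lim by (rule tendsto_unique[rotated]) simp
  then have "c < energy (\<omega> 0)"
    using pos by (simp add: energy_0 field_simps)
  with c show "\<forall>t\<in>{0<..<T}. energy (\<omega> 0) > energy (\<omega> t)" by simp
qed

end
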